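(* Let $a$ and $b$ be distinct positive integers and let $$\xi_{a,b}=[0,a,b,a,a,b,a,\dots]=1/(a+1/(b+\cdots))$$ be the real number whose sequence of partial quotients (in its continued fraction expansion) starts with $0$ followed by the elements of the Fibonacci word on $\{a,b\}$. Then $\xi_{a,b}$ is an extremal real number. Moreover, with $$A=\begin{pmatrix} a & 1 \\ 1 & 0 \end{pmatrix}\quad\text{and}\quad B=\begin{pmatrix} b & 1 \\ 1 & 0 \end{pmatrix},$$ the matrices $A,B$ are non-commuting symmetric elements of $\mathrm{GL}_2(\mathbb{Z})$ such that $A$ has non-negative coefficients and $AB$ has positive coefficients, and if $(\mathbf{y}_k)_{k\ge-1}$, $\mathbf{y}_k=(y_{k,0},y_{k,1},y_{k,2})$, is the sequence defined by $\mathbf{y}_{-1}=B^{-1}$, $\mathbf{y}_0=I$, $\mathbf{y}_1=A$ and $\mathbf{y}_k=[\mathbf{y}_{k-1},\mathbf{y}_{k-1},\mathbf{y}_{k-3}]$ for $k\ge2$, then $\xi_{a,b}=\lim_{k\to\infty}y_{k,1}/y_{k,0}$.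
   Context: The Fibonacci word on $\{a,b\}$ is the infinite word $w=abaabab\dots$ which is the limit of the words $w_i$ defined by $w_0=b$, $w_1=a$, $w_i=w_{i-1}w_{i-2}$ (concatenation) for $i\ge2$; each $w_i$ with $i\ge1$ is a prefix of $w_{i+1}$. Let $\gamma=(1+\sqrt5)/2$. A real number $\xi$ is called extremal if it is neither rational nor quadratic irrational (i.e. not algebraic over $\mathbb{Q}$ of degree at most $2$) and there exists a constant $c'>0$ such that, for every real number $X\ge 1$, the inequalities $|x_0|\le X$, $|x_0\xi-x_1|\le c'X^{-1/\gamma}$, $|x_0\xi^2-x_2|\le c'X^{-1/\gamma}$ have a non-zero solution $(x_0,x_1,x_2)\in\mathbb{Z}^3$. A point $\mathbf{x}=(x_0,x_1,x_2)\in\mathbb{Z}^3$ is identified with the symmetric matrix $\begin{pmatrix} x_0 & x_1 \\ x_1 & x_2 \end{pmatrix}$. With $J=\begin{pmatrix} 0 & 1 \\ -1 & 0 \end{pmatrix}$, the matrix $-\mathbf{x}J\mathbf{z}J\mathbf{x}$ is always symmetric, and $[\mathbf{x},\mathbf{x},\mathbf{z}]=-\mathbf{x}J\mathbf{z}J\mathbf{x}$ denotes the corresponding point of $\mathbb{Z}^3$. $I$ is the $2\times2$ identity matrix. *)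

theory Defs
  imports "HOL-Analysis.Analysis" "HOL-Computational_Algebra.Polynomial"
begin

fun fib_words :: "'a \<Rightarrow> 'a \<Rightarrow> nat \<Rightarrow> 'a list" where
  "fib_words a b 0 = [b]"
| "fib_words a b (Suc 0) = [a]"
| "fib_words a b (Suc (Suc i)) = fib_words a b (Suc i) @ fib_words a b i"

text \<open>The limit of the words: \<^term>\<open>fib_words a b (Suc n)\<close> has at least \<^term>\<open>Suc n\<close> letters and is
  a prefix of all later words, so its letter number \<^term>\<open>n\<close> (counting from 0) is the final one;
  see \<open>fib_word_nth\<close> below.\<close>

definition fib_word :: "'a \<Rightarrow> 'a \<Rightarrow> nat \<Rightarrow> 'a" where
  "fib_word a b n = fib_words a b (Suc n) ! n"

lemma fib_words_length: "i \<le> length (fib_words a b i) \<and> 1 \<le> length (fib_words a b i)"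
  by (induction a b i rule: fib_words.induct) auto

lemma fib_words_prefix:
  assumes "1 \<le> i" "i \<le> j"
  shows "\<exists>zs. fib_words a b j = fib_words a b i @ zs"
  using assms(2)
proof (induction j rule: dec_induct)
  case base
  show ?case by simp
next
  case (step j)
  obtain m where j: "j = Suc m"
    using assms(1) step.hyps by (cases j) auto
  obtain zs where "fib_words a b j = fib_words a b i @ zs"
    using step.IH by blast
  then have "fib_words a b (Suc j) = fib_words a b i @ (zs @ fib_words a b m)"
    by (simp add: j)
  then show ?case
    by blast
qed

lemma fib_word_nth:
  assumes "1 \<le> i" "n < length (fib_words a b i)"
  shows "fib_word a b n = fib_words a b i ! n"
proof (cases "i \<le> Suc n")
  case True
  obtain zs where zs: "fib_words a b (Suc n) = fib_words a b i @ zs"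
    using fib_words_prefix[OF assms(1) True, of a b] by (elim exE)
  show ?thesis
    unfolding fib_word_def zs nth_append using assms(2) by (simp only: if_True)
next
  case False
  then have "1 \<le> Suc n" "Suc n \<le> i"
    by linarith+
  then obtain zs where zs: "fib_words a b i = fib_words a b (Suc n) @ zs"
    by (elim exE[OF fib_words_prefix])
  have "n < length (fib_words a b (Suc n))"
    using fib_words_length[of "Suc n" a b] by linarith
  then show ?thesis
    unfolding fib_word_def zs nth_append by (simp only: if_True)
qed

primrec cf_convergent :: "(nat \<Rightarrow> int) \<Rightarrow> nat \<Rightarrow> real" where
  "cf_convergent c 0 = of_int (c 0)"
| "cf_convergent c (Suc n) = of_int (c 0) + 1 / cf_convergent (\<lambda>i. c (Suc i)) n"

text \<open>Unspecified if the convergents diverge; they converge whenever \<open>c i > 0\<close> for all \<open>i \<ge> 1\<close>.\<close>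

definition cf_value :: "(nat \<Rightarrow> int) \<Rightarrow> real" where
  "cf_value c = lim (cf_convergent c)"

definition fib_cf :: "int \<Rightarrow> int \<Rightarrow> real" where
  "fib_cf a b = cf_value (case_nat 0 (fib_word a b))"

definition golden :: real where
  "golden = (1 + sqrt 5) / 2"

definition algebraic_deg_le2 :: "real \<Rightarrow> bool" where
  "algebraic_deg_le2 \<xi> \<longleftrightarrow>
     (\<exists>p :: rat poly. p \<noteq> 0 \<and> degree p \<le> 2 \<and> poly (map_poly of_rat p) \<xi> = 0)"

definition extremal :: "real \<Rightarrow> bool" where
  "extremal \<xi> \<longleftrightarrow>
     \<not> algebraic_deg_le2 \<xi> \<and>
     (\<exists>c'>0. \<forall>X::real. X \<ge> 1 \<longrightarrow>
        (\<exists>x0 x1 x2 :: int. (x0, x1, x2) \<noteq> (0, 0, 0) \<and>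
           \<bar>of_int x0\<bar> \<le> X \<and>
           \<bar>of_int x0 * \<xi> - of_int x1\<bar> \<le> c' * X powr (- 1 / golden) \<and>
           \<bar>of_int x0 * \<xi>\<^sup>2 - of_int x2\<bar> \<le> c' * X powr (- 1 / golden)))"

text \<open>A point \<open>(x\<^sub>0, x\<^sub>1, x\<^sub>2)\<close> is a vector \<open>x :: int ^ 3\<close> with \<open>x\<^sub>0 = x $ 1\<close>, \<open>x\<^sub>1 = x $ 2\<close>,
  \<open>x\<^sub>2 = x $ 3\<close> (in the index type \<open>3\<close>, the index \<open>0\<close> equals \<open>3\<close>).\<close>

definition point_matrix :: "int ^ 3 \<Rightarrow> int ^ 2 ^ 2" where
  "point_matrix x = vector [vector [x $ 1, x $ 2], vector [x $ 2, x $ 3]]"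

text \<open>Inverse of \<^const>\<open>point_matrix\<close> on symmetric matrices; only meaningful there.\<close>

definition matrix_point :: "int ^ 2 ^ 2 \<Rightarrow> int ^ 3" where
  "matrix_point M = vector [M $ 1 $ 1, M $ 1 $ 2, M $ 2 $ 2]"

definition J :: "int ^ 2 ^ 2" where
  "J = vector [vector [0, 1], vector [- 1, 0]]"

text \<open>\<open>bracket x z\<close> is \<open>[x, x, z]\<close>.\<close>

definition bracket :: "int ^ 3 \<Rightarrow> int ^ 3 \<Rightarrow> int ^ 3" where
  "bracket x z =
     matrix_point (- (point_matrix x ** J ** point_matrix z ** J ** point_matrix x))"

lemma point_matrix_bracket:
  "point_matrix (bracket x z) =
     - (point_matrix x ** J ** point_matrix z ** J ** point_matrix x)"
  by (simp add: bracket_def point_matrix_def matrix_point_def J_def vec_eq_iff forall_2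
      matrix_matrix_mult_def sum_2 algebra_simps)

text \<open>The indices start at \<open>- 1\<close>; the value at smaller integers is irrelevant.
  \<^const>\<open>matrix_inv\<close> is the inverse over the integers, meaningful for \<open>B\<close> in \<open>GL\<^sub>2(\<int>)\<close>.\<close>

function y_seq :: "int ^ 2 ^ 2 \<Rightarrow> int ^ 2 ^ 2 \<Rightarrow> int \<Rightarrow> int ^ 3" where
  "y_seq A B k =
     (if k \<le> - 1 then matrix_point (matrix_inv B)
      else if k = 0 then matrix_point (mat 1)
      else if k = 1 then matrix_point A
      else bracket (y_seq A B (k - 1)) (y_seq A B (k - 3)))"
  by auto
termination
  by (relation "Wellfounded.measure (\<lambda>(A, B, k). nat (k + 1))") auto

declare y_seq.simps [simp del]

end

theory Submission
  imports Defs
begin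

text \<open>
  Let \<open>m\<^sub>k\<close> be the product of the matrices \<open>A\<close> and \<open>B\<close> along the \<open>k\<close>-th palindromic prefix
  \<open>\<epsilon>, a, aba, abaaba, \<dots>\<close> of the Fibonacci word. The columns of \<open>m\<^sub>k\<close> hold two successive convergents of
  \<open>\<xi>\<close>, and \<open>m\<^sub>k\<close> is symmetric because the prefix is a palindrome. With \<open>X\<^sub>k\<close> the upper left entry, both
  errors \<open>X\<^sub>k \<xi> - m\<^bsub>k,12\<^esub>\<close> and \<open>X\<^sub>k \<xi>\<^sup>2 - m\<^bsub>k,22\<^esub>\<close> are therefore \<open>O(1 / X\<^sub>k)\<close> (\<open>fib_cf_approx1\<close>,
  \<open>fib_cf_approx2\<close>).

  The palindromic prefixes satisfy \<open>m\<^bsub>k+2\<^esub> = m\<^bsub>k+1\<^esub> N m\<^sub>k\<close>, where \<open>N\<close> is \<open>AB\<close> or \<open>BA\<close>. This has three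
  consequences. First, \<open>X\<^bsub>k+2\<^esub>\<close> is \<open>X\<^bsub>k+1\<^esub> X\<^sub>k\<close> up to a bounded factor, which forces
  \<open>X\<^bsub>k+1\<^esub> = O(X\<^sub>k\<^sup>\<gamma>)\<close> with the golden ratio \<open>\<gamma>\<close>; so the points \<open>m\<^sub>k\<close> solve the inequalities of an
  extremal number at every scale (\<open>fibonacci_growth\<close>, \<open>next_term_bound\<close>). Second, three consecutive
  points are linearly independent, with determinant \<open>\<plusminus> (a - b)\<close>. An integer relation
  \<open>u + v \<xi> + w \<xi>\<^sup>2 = 0\<close> would define a linear form that takes integer values tending to \<open>0\<close> at the points
  \<open>m\<^sub>k\<close>; it would vanish at three consecutive ones and hence identically
  (\<open>linear_form_zero_of_symmetric_triple\<close>, \<open>not_algebraic_deg_le2_criterion\<close>). Third, transposing the recursion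
  gives \<open>m\<^bsub>k+2\<^esub> = m\<^sub>k N\<^sup>T m\<^bsub>k+1\<^esub>\<close>, and the two forms combine to \<open>m\<^bsub>k+3\<^esub> = m\<^bsub>k+2\<^esub> m\<^sub>k\<^sup>-\<^sup>1 m\<^bsub>k+2\<^esub>\<close>. Up to
  sign this is the bracket recursion, so \<open>y\<^sub>k = \<plusminus> m\<^sub>k\<close> (\<open>y_seq_central_word\<close>) and the ratios of coordinates
  of \<open>y\<^sub>k\<close> are convergents of \<open>\<xi>\<close>.
\<close>

section \<open>Matrices of continued fractions\<close>

text \<open>The partial quotients \<open>c\<^sub>1, \<dots>, c\<^sub>n\<close> produce the matrix with first column \<open>(q\<^sub>n, p\<^sub>n)\<close> and
  second column \<open>(q\<^bsub>n-1\<^esub>, p\<^bsub>n-1\<^esub>)\<close>, where \<open>p\<^sub>i / q\<^sub>i\<close> are the convergents of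
  \<open>[0, c\<^sub>1, \<dots>, c\<^sub>n]\<close>.\<close>

primrec cf_matrix :: "int list \<Rightarrow> int ^ 2 ^ 2" where
  "cf_matrix [] = mat 1"
| "cf_matrix (c # cs) = vector [vector [c, 1], vector [1, 0]] ** cf_matrix cs"

lemma cf_matrix_append: "cf_matrix (us @ vs) = cf_matrix us ** cf_matrix vs"
  by (induction us) (simp_all add: matrix_mul_assoc)

lemma matrix_mult_2_entries:
  fixes M N :: "'a::semiring_1 ^ 2 ^ 2"
  shows "(M ** N) $ i $ j = M $ i $ 1 * N $ 1 $ j + M $ i $ 2 * N $ 2 $ j"
  by (simp add: matrix_matrix_mult_def sum_2)

lemma transpose_2_entries: "transpose M = M \<Longrightarrow> M $ 2 $ 1 = (M :: 'a ^ 2 ^ 2) $ 1 $ 2"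
  by (simp only: transpose_def vec_eq_iff vec_lambda_beta)

lemma cf_matrix_Cons_entries:
  "cf_matrix (c # cs) $ 1 $ j = c * cf_matrix cs $ 1 $ j + cf_matrix cs $ 2 $ j"
  "cf_matrix (c # cs) $ 2 $ j = cf_matrix cs $ 1 $ j"
  by (simp_all add: matrix_mult_2_entries)

text \<open>The factors are symmetric, so transposition reverses their order. In particular the matrix of
  a palindrome is symmetric, and it is then a point of \<open>\<int>\<^sup>3\<close>.\<close>

lemma cf_matrix_rev: "cf_matrix (rev ws) = transpose (cf_matrix ws)"
proof (induction ws)
  case Nil
  show ?case by (simp add: transpose_mat)
next
  case (Cons c ws)
  have "transpose (vector [vector [c, 1], vector [1, 0]] :: int ^ 2 ^ 2)
      = vector [vector [c, 1], vector [1, 0]]"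
    by (simp add: transpose_def vec_eq_iff forall_2)
  with Cons show ?case
    by (simp add: cf_matrix_append matrix_transpose_mul)
qed

lemma det_cf_matrix: "det (cf_matrix ws) = (- 1) ^ length ws"
proof (induction ws)
  case (Cons c ws)
  have "det (vector [vector [c, 1], vector [1, 0]] :: int ^ 2 ^ 2) = - 1"
    by (simp add: det_2)
  with Cons show ?case by (simp add: det_mul)
qed simp

text \<open>Prepending a letter increases the denominator by at least the numerator, which is positive for
  a non-empty word; so denominators grow at least linearly. Induction on the first letter controls
  the first column; the bound for the upper right entry is the bound for the lower left entry of
  the reversed word.\<close>

lemma cf_matrix_entries:
  assumes "\<forall>c\<in>set ws. c > 0"
  shows "cf_matrix ws $ 1 $ 1 \<ge> 1"
    and "cf_matrix ws $ i $ j \<ge> 0"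
    and "cf_matrix ws $ i $ j \<le> cf_matrix ws $ 1 $ 1"
    and "int (length ws) \<le> cf_matrix ws $ 1 $ 1"
proof -
  have base: "cf_matrix us $ 1 $ 1 \<ge> 1 \<and> (\<forall>i j. cf_matrix us $ i $ j \<ge> 0) \<and>
      cf_matrix us $ 2 $ 1 \<le> cf_matrix us $ 1 $ 1 \<and>
      int (length us) \<le> cf_matrix us $ 1 $ 1 \<and> (us \<noteq> [] \<longrightarrow> cf_matrix us $ 2 $ 1 \<ge> 1)"
    if "\<forall>c\<in>set us. c > 0" for us
    using that
  proof (induction us)
    case Nil
    show ?case by (simp add: mat_def forall_2)
  next
    case (Cons c us)
    let ?P = "cf_matrix us"
    have IH: "?P $ 1 $ 1 \<ge> 1" "?P $ i $ j \<ge> 0" "int (length us) \<le> ?P $ 1 $ 1"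
        "us \<noteq> [] \<Longrightarrow> ?P $ 2 $ 1 \<ge> 1" for i j
      using Cons by auto
    have "c \<ge> 1" using Cons.prems by auto
    then have c: "c * ?P $ 1 $ j \<ge> ?P $ 1 $ j" for j
      using mult_right_mono[of 1 c "?P $ 1 $ j"] IH(2) by simp
    have "int (length (c # us)) \<le> c * ?P $ 1 $ 1 + ?P $ 2 $ 1"
    proof (cases "us = []")
      case True
      then show ?thesis using \<open>c \<ge> 1\<close> by (simp add: mat_def)
    next
      case False
      then show ?thesis using IH(3,4) c[of 1] by simp
    qed
    with IH(1) IH(2)[of 1 1] IH(2)[of 1 2] IH(2)[of 2 1] IH(2)[of 2 2] c[of 1] c[of 2]
    show ?case
      unfolding forall_2 cf_matrix_Cons_entries by linarith
  qed
  have nonneg: "\<forall>i j. cf_matrix ws $ i $ j \<ge> 0" and 21: "cf_matrix ws $ 2 $ 1 \<le> cf_matrix ws $ 1 $ 1"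
    using base[OF assms] by auto
  have 12: "cf_matrix ws $ 1 $ 2 \<le> cf_matrix ws $ 1 $ 1"
    using base[of "rev ws"] assms by (simp add: cf_matrix_rev transpose_def)
  have 22: "cf_matrix ws $ 2 $ 2 \<le> cf_matrix ws $ 1 $ 1"
  proof (cases ws)
    case Nil
    then show ?thesis by (simp add: mat_def)
  next
    case (Cons c us)
    let ?P = "cf_matrix us"
    have us: "\<forall>c\<in>set us. c > 0" "c \<ge> 1" using assms Cons by auto
    have "?P $ 1 $ 2 \<le> ?P $ 1 $ 1"
      using base[of "rev us"] us by (simp add: cf_matrix_rev transpose_def)
    moreover have "?P $ 1 $ 1 \<le> c * ?P $ 1 $ 1" "0 \<le> ?P $ 2 $ 1"
      using base[OF us(1)] us(2) mult_right_mono[of 1 c "?P $ 1 $ 1"] by auto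
    ultimately show ?thesis
      unfolding Cons cf_matrix_Cons_entries by linarith
  qed
  show "cf_matrix ws $ 1 $ 1 \<ge> 1" "int (length ws) \<le> cf_matrix ws $ 1 $ 1"
    using base[OF assms] by auto
  show "cf_matrix ws $ i $ j \<ge> 0"
    using nonneg by blast
  have "\<forall>i j. cf_matrix ws $ i $ j \<le> cf_matrix ws $ 1 $ 1"
    unfolding forall_2 using 12 21 22 by simp
  then show "cf_matrix ws $ i $ j \<le> cf_matrix ws $ 1 $ 1" by blast
qed

section \<open>Convergents\<close>

lemma cf_convergent_matrix:
  assumes "\<And>n. f n > 0"
  shows "cf_convergent (case_nat c f) n = of_int c +
    of_int (cf_matrix (map f [0..<n]) $ 2 $ 1) / of_int (cf_matrix (map f [0..<n]) $ 1 $ 1)"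
  using assms
proof (induction n arbitrary: c f)
  case 0
  show ?case by (simp add: mat_def)
next
  case (Suc n)
  let ?g = "\<lambda>i. f (Suc i)"
  let ?P = "cf_matrix (map ?g [0..<n])"
  have pos: "?P $ 1 $ 1 \<ge> 1"
    using Suc.prems by (intro cf_matrix_entries) auto
  have f: "f = case_nat (f 0) ?g"
    by (auto split: nat.split)
  have l: "map f [0..<Suc n] = f 0 # map ?g [0..<n]"
    by (metis map_upt_Suc)
  have "cf_convergent (case_nat c f) (Suc n) = of_int c + 1 / cf_convergent f n"
    by simp
  also have "cf_convergent f n = of_int (f 0) + of_int (?P $ 2 $ 1) / of_int (?P $ 1 $ 1)"
    using Suc.IH[of ?g "f 0"] Suc.prems by (subst f) simp
  also have "\<dots> = of_int (f 0 * ?P $ 1 $ 1 + ?P $ 2 $ 1) / of_int (?P $ 1 $ 1)"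
    using pos by (simp add: field_simps)
  finally show ?case
    unfolding l cf_matrix_Cons_entries by simp
qed

text \<open>With \<open>Q = P R\<close> the matrix of the extended word, the number \<open>P\<^bsub>1j\<^esub> Q\<^sub>2\<^sub>1 - P\<^bsub>2j\<^esub> Q\<^sub>1\<^sub>1\<close> is, up to the
  sign \<open>det P\<close>, an entry of the first column of \<open>R\<close>; so it is at most \<open>R\<^sub>1\<^sub>1 \<le> Q\<^sub>1\<^sub>1 / P\<^sub>1\<^sub>1\<close>. The bound does not
  depend on the extension and therefore passes to the limit.\<close>

lemma convergent_of_extension:
  fixes us vs :: "int list"
  defines "t \<equiv> of_int (cf_matrix (us @ vs) $ 2 $ 1) / of_int (cf_matrix (us @ vs) $ 1 $ 1) :: real"
  assumes "\<forall>c\<in>set us. c > 0" "\<forall>c\<in>set vs. c > 0"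
  shows "\<bar>of_int (cf_matrix us $ 1 $ j) * t - of_int (cf_matrix us $ 2 $ j)\<bar>
    \<le> 1 / of_int (cf_matrix us $ 1 $ 1)"
proof -
  define P R Q where "P = cf_matrix us" and "R = cf_matrix vs" and "Q = cf_matrix (us @ vs)"
  have Q: "Q $ i $ k = P $ i $ 1 * R $ 1 $ k + P $ i $ 2 * R $ 2 $ k" for i k
    unfolding P_def Q_def R_def cf_matrix_append matrix_mult_2_entries ..
  have pos: "P $ 1 $ 1 \<ge> 1" "R $ 1 $ 1 \<ge> 1" "R $ i $ 1 \<ge> 0" "R $ i $ 1 \<le> R $ 1 $ 1" "P $ 1 $ 2 \<ge> 0" for i
    unfolding P_def R_def using assms cf_matrix_entries by blast+
  have "\<bar>det P\<bar> = 1"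
    unfolding P_def det_cf_matrix by (simp add: power_abs)
  have Q_ge: "Q $ 1 $ 1 \<ge> P $ 1 $ 1 * R $ 1 $ 1"
    using Q pos by simp
  moreover have "P $ 1 $ 1 * R $ 1 $ 1 \<ge> 1 * 1"
    using pos by (intro mult_mono) auto
  ultimately have Q1: "Q $ 1 $ 1 \<ge> 1" by simp
  have "\<bar>P $ 1 $ j * Q $ 2 $ 1 - P $ 2 $ j * Q $ 1 $ 1\<bar> \<le> R $ 1 $ 1"
  proof -
    have "P $ 1 $ 1 * Q $ 2 $ 1 - P $ 2 $ 1 * Q $ 1 $ 1 = det P * R $ 2 $ 1"
      "P $ 1 $ 2 * Q $ 2 $ 1 - P $ 2 $ 2 * Q $ 1 $ 1 = - (det P * R $ 1 $ 1)"
      unfolding Q det_2 by (simp_all add: algebra_simps)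
    then have "\<forall>j. \<bar>P $ 1 $ j * Q $ 2 $ 1 - P $ 2 $ j * Q $ 1 $ 1\<bar> \<le> R $ 1 $ 1"
      unfolding forall_2 using pos \<open>\<bar>det P\<bar> = 1\<close> by (simp add: abs_mult)
    then show ?thesis by blast
  qed
  then have "P $ 1 $ 1 * \<bar>P $ 1 $ j * Q $ 2 $ 1 - P $ 2 $ j * Q $ 1 $ 1\<bar> \<le> P $ 1 $ 1 * R $ 1 $ 1"
    using pos(1) by (intro mult_left_mono) auto
  with Q_ge have "P $ 1 $ 1 * \<bar>P $ 1 $ j * Q $ 2 $ 1 - P $ 2 $ j * Q $ 1 $ 1\<bar> \<le> Q $ 1 $ 1"
    by linarith
  then have *: "real_of_int (P $ 1 $ 1) * \<bar>of_int (P $ 1 $ j) * of_int (Q $ 2 $ 1) - of_int (P $ 2 $ j) * of_int (Q $ 1 $ 1)\<bar>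
      \<le> of_int (Q $ 1 $ 1)"
    by (simp flip: of_int_mult of_int_diff of_int_abs)
  have "\<bar>of_int (P $ 1 $ j) * t - of_int (P $ 2 $ j)\<bar>
      = \<bar>of_int (P $ 1 $ j) * of_int (Q $ 2 $ 1) - of_int (P $ 2 $ j) * of_int (Q $ 1 $ 1)\<bar> / of_int (Q $ 1 $ 1)"
    using Q1 unfolding t_def Q_def[symmetric] by (simp add: field_simps abs_if)
  also have "\<dots> \<le> 1 / of_int (P $ 1 $ 1)"
    using * Q1 pos(1) by (simp add: field_simps)
  finally show ?thesis unfolding P_def .
qed

text \<open>For \<open>j = 1\<close> the estimates for extensions make the convergents a Cauchy sequence, with
  \<open>\<bar>T m - T n\<bar> \<le> 1 / n\<close> for \<open>m \<ge> n\<close>; the case \<open>j = 2\<close> bounds the error of the preceding convergent, and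
  it is what controls the approximation of the square of the limit later on.\<close>

lemma
  fixes f :: "nat \<Rightarrow> int"
  assumes pos: "\<And>n. f n > 0"
  shows cf_convergent_tendsto: "cf_convergent (case_nat 0 f) \<longlonglongrightarrow> cf_value (case_nat 0 f)"
    and cf_value_approx: "\<bar>of_int (cf_matrix (map f [0..<n]) $ 1 $ j) * cf_value (case_nat 0 f)
      - of_int (cf_matrix (map f [0..<n]) $ 2 $ j)\<bar> \<le> 1 / of_int (cf_matrix (map f [0..<n]) $ 1 $ 1)"
proof -
  define P where "P n = cf_matrix (map f [0..<n])" for n
  define T where "T = cf_convergent (case_nat 0 f)"
  have T: "T n = of_int (P n $ 2 $ 1) / of_int (P n $ 1 $ 1)" for n
    unfolding T_def P_def using cf_convergent_matrix[where f = f and c = 0 and n = n] pos by simp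
  have P: "P n $ 1 $ 1 \<ge> 1" "int n \<le> P n $ 1 $ 1" for n
    unfolding P_def using pos cf_matrix_entries[of "map f [0..<n]"] by auto
  have approx: "\<bar>of_int (P n $ 1 $ j) * T m - of_int (P n $ 2 $ j)\<bar> \<le> 1 / of_int (P n $ 1 $ 1)"
    if "n \<le> m" for n m j
  proof -
    have "map f [0..<m] = map f [0..<n] @ map f [n..<m]"
      using that by (metis le_add_diff_inverse map_append upt_add_eq_append zero_le)
    then show ?thesis
      using convergent_of_extension[of "map f [0..<n]" "map f [n..<m]" j] pos
      unfolding T P_def by simp
  qed
  have close: "\<bar>T m - T n\<bar> \<le> 1 / n" if "n > 0" "n \<le> m" for n m
  proof -
    have "real_of_int (P n $ 1 $ 1) * \<bar>T m - T n\<bar>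
        = \<bar>of_int (P n $ 1 $ 1) * T m - of_int (P n $ 2 $ 1)\<bar>"
      using P(1)[of n] unfolding T[of n] by (simp add: field_simps abs_if)
    also have "\<dots> \<le> 1"
      using approx[OF that(2), of 1] P(1)[of n] by (smt (verit) divide_le_eq_1 of_int_1_le_iff)
    finally have *: "real_of_int (P n $ 1 $ 1) * \<bar>T m - T n\<bar> \<le> 1" .
    have "real n \<le> of_int (P n $ 1 $ 1)"
      using P(2)[of n] by linarith
    then have "real n * \<bar>T m - T n\<bar> \<le> 1"
      using * mult_right_mono[of "real n" "of_int (P n $ 1 $ 1)" "\<bar>T m - T n\<bar>"] by simp
    then show ?thesis using that(1) by (simp add: field_simps)
  qed
  have "Cauchy T"
  proof (rule CauchyI')
    fix e :: real assume "e > 0"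
    then obtain M :: nat where M: "M > 0" "1 / M < e"
      using ex_inverse_of_nat_less[of e] by (auto simp: inverse_eq_divide)
    have "dist (T m) (T n) < e" if "M \<le> m" "m < n" for m n
    proof -
      have "1 / real m \<le> 1 / real M"
        using that M by (intro divide_left_mono) auto
      then show ?thesis
        using close[of m n] that M by (simp add: dist_real_def abs_minus_commute)
    qed
    then show "\<exists>M. \<forall>m\<ge>M. \<forall>n>m. dist (T m) (T n) < e" by blast
  qed
  then show conv: "cf_convergent (case_nat 0 f) \<longlonglongrightarrow> cf_value (case_nat 0 f)"
    unfolding cf_value_def T_def[symmetric] by (simp add: Cauchy_convergent convergent_LIMSEQ_iff[symmetric])
  have "(\<lambda>m. \<bar>of_int (P n $ 1 $ j) * T m - of_int (P n $ 2 $ j)\<bar>)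
      \<longlonglongrightarrow> \<bar>of_int (P n $ 1 $ j) * cf_value (case_nat 0 f) - of_int (P n $ 2 $ j)\<bar>"
    using conv unfolding T_def by (intro tendsto_intros)
  then have "\<bar>of_int (P n $ 1 $ j) * cf_value (case_nat 0 f) - of_int (P n $ 2 $ j)\<bar> \<le> 1 / of_int (P n $ 1 $ 1)"
    using approx by (intro LIMSEQ_le_const2) blast+
  then show "\<bar>of_int (cf_matrix (map f [0..<n]) $ 1 $ j) * cf_value (case_nat 0 f)
      - of_int (cf_matrix (map f [0..<n]) $ 2 $ j)\<bar> \<le> 1 / of_int (cf_matrix (map f [0..<n]) $ 1 $ 1)"
    unfolding P_def .
qed

section \<open>Palindromic prefixes of the Fibonacci word\<close>

text \<open>The two letters that complete a palindromic prefix to the next Fibonacci word; they alternate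
  between \<open>ab\<close> and \<open>ba\<close>.\<close>

definition pair_word :: "'a \<Rightarrow> 'a \<Rightarrow> nat \<Rightarrow> 'a list" where
  "pair_word a b k = (if even k then [a, b] else [b, a])"

text \<open>The palindromic prefixes \<open>\<epsilon>, a, aba, abaaba, \<dots>\<close>. They arise from the Fibonacci words by
  deleting the last two letters, which turns \<open>w\<^bsub>k+2\<^esub> = w\<^bsub>k+1\<^esub> w\<^sub>k\<close> into this recursion.\<close>

fun central_word :: "'a \<Rightarrow> 'a \<Rightarrow> nat \<Rightarrow> 'a list" where
  "central_word a b 0 = []"
| "central_word a b (Suc 0) = [a]"
| "central_word a b (Suc (Suc k)) =
     central_word a b (Suc k) @ pair_word a b (Suc k) @ central_word a b k"

lemma pair_word_Suc_Suc: "pair_word a b (Suc (Suc k)) = pair_word a b k"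
  by (simp add: pair_word_def)

lemma rev_pair_word: "rev (pair_word a b k) = pair_word a b (Suc k)"
  by (simp add: pair_word_def)

lemma fib_words_central_word:
  "fib_words a b (Suc (Suc k)) = central_word a b k @ pair_word a b k"
proof (induction k rule: induct_nat_012)
  case (ge2 k)
  then show ?case
    by (metis append.assoc central_word.simps(3) fib_words.simps(3) pair_word_Suc_Suc)
qed (simp_all add: pair_word_def)

text \<open>The second factorization of the same word. It is the mirror image of the recursion, so
  together they force the words to be palindromes; it also exhibits each word as an extension of
  the word two steps before, which is what inverting the matrix of that word requires.\<close>

lemma central_word_swap:
  "central_word a b (Suc (Suc k)) = central_word a b k @ pair_word a b k @ central_word a b (Suc k)"
proof (induction k)
  case 0
  show ?case by (simp add: pair_word_def)
next
  case (Suc k)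
  have "central_word a b (Suc (Suc (Suc k)))
      = central_word a b (Suc (Suc k)) @ pair_word a b (Suc (Suc k)) @ central_word a b (Suc k)"
    by simp
  also have "\<dots> = central_word a b (Suc k) @ pair_word a b (Suc k) @
      (central_word a b k @ pair_word a b k @ central_word a b (Suc k))"
    by (simp add: pair_word_Suc_Suc)
  also have "central_word a b k @ pair_word a b k @ central_word a b (Suc k) = central_word a b (Suc (Suc k))"
    by (simp only: Suc.IH)
  finally show ?case .
qed

lemma rev_central_word: "rev (central_word a b k) = central_word a b k"
proof (induction k rule: induct_nat_012)
  case (ge2 k)
  then show ?case
    by (subst (2) central_word_swap) (simp add: rev_pair_word pair_word_Suc_Suc)
qed simp_all

lemma set_central_word: "set (central_word a b k) \<subseteq> {a, b}"
  by (induction k rule: induct_nat_012) (auto simp: pair_word_def)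

lemma length_central_word: "k \<le> length (central_word a b k)"
  by (induction k rule: induct_nat_012) (auto simp: pair_word_def)

lemma central_word_prefix:
  "map (fib_word a b) [0..<length (central_word a b k)] = central_word a b k"
proof (rule nth_equalityI)
  fix n assume "n < length (map (fib_word a b) [0..<length (central_word a b k)])"
  then have n: "n < length (central_word a b k)" by simp
  have "fib_word a b n = fib_words a b (Suc (Suc k)) ! n"
    using n by (intro fib_word_nth) (simp_all add: fib_words_central_word del: fib_words.simps)
  then show "map (fib_word a b) [0..<length (central_word a b k)] ! n = central_word a b k ! n"
    using n by (simp add: fib_words_central_word nth_append del: fib_words.simps)
qed simp

lemma fib_word_in: "fib_word a b n \<in> {a, b}"
proof -
  have "set (fib_words a b i) \<subseteq> {a, b}" for i
    by (induction a b i rule: fib_words.induct) auto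
  moreover have "n < length (fib_words a b (Suc n))"
    using fib_words_length[of "Suc n" a b] by linarith
  ultimately show ?thesis
    unfolding fib_word_def using nth_mem by blast
qed

section \<open>Sequences growing like Fibonacci products\<close>

lemma golden_props: "golden > 1" "golden * golden = golden + 1"
proof -
  have "sqrt 5 > 1" by simp
  then show "golden > 1" by (simp add: golden_def)
  show "golden * golden = golden + 1" by (simp add: golden_def field_simps)
qed

text \<open>On the logarithmic scale the hypotheses read \<open>L\<^bsub>k+2\<^esub> = L\<^bsub>k+1\<^esub> + L\<^sub>k + O(1)\<close>. Since
  \<open>\<gamma>\<^sup>2 = \<gamma> + 1\<close>, the defect \<open>D\<^sub>k = L\<^bsub>k+1\<^esub> - \<gamma> L\<^sub>k\<close> satisfies \<open>D\<^bsub>k+1\<^esub> = - D\<^sub>k / \<gamma> + O(1)\<close>, a contraction up to a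
  bounded error, and so it stays bounded.\<close>

lemma fibonacci_growth:
  fixes X :: "nat \<Rightarrow> real"
  assumes pos: "\<And>k. X k > 0"
    and lower: "\<And>k. X (Suc k) * X k \<le> X (Suc (Suc k))"
    and upper: "\<And>k. X (Suc (Suc k)) \<le> C * (X (Suc k) * X k)"
  shows "\<exists>c>0. \<forall>k. X (Suc k) \<le> c * X k powr golden"
proof -
  define D where "D k = ln (X (Suc k)) - golden * ln (X k)" for k
  \<comment> \<open>The error term is at most \<open>ln C\<close>, so an invariant bound \<open>K\<close> needs \<open>K / \<gamma> + ln C \<le> K\<close>; as
    \<open>1 / (1 - 1 / \<gamma>) = \<gamma> + 1\<close>, this is \<open>K \<ge> (\<gamma> + 1) ln C\<close>.\<close>
  define K where "K = \<bar>D 0\<bar> + (golden + 1) * ln C"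
  have g: "golden > 1" "golden * golden = golden + 1" by (rule golden_props)+
  have prod: "X (Suc k) * X k > 0" for k using pos by simp
  have "1 * (X (Suc 0) * X 0) \<le> C * (X (Suc 0) * X 0)"
    using lower[of 0] upper[of 0] by simp
  then have C: "C \<ge> 1"
    using prod[of 0] by (simp only: mult_le_cancel_right_pos)
  have "K / golden + ln C \<le> K"
  proof -
    have "golden = (golden - 1) * (golden + 1)"
      using g(2) by (simp add: algebra_simps)
    then have "golden * ln C = (golden - 1) * ((golden + 1) * ln C)"
      by (metis mult.assoc)
    also have "\<dots> \<le> (golden - 1) * K"
      using g unfolding K_def by (intro mult_left_mono) auto
    finally show ?thesis using g(1) by (simp add: field_simps)
  qed
  have bound: "\<bar>D k\<bar> \<le> K" for k
  proof (induction k)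
    case 0
    show ?case using C g(1) by (simp add: K_def)
  next
    case (Suc k)
    have "ln (X (Suc k) * X k) \<le> ln (X (Suc (Suc k)))"
      "ln (X (Suc (Suc k))) \<le> ln (C * (X (Suc k) * X k))"
      using lower[of k] upper[of k] prod[of k] pos by (simp_all only: ln_le_cancel_iff ln_mono)
    then have e: "0 \<le> ln (X (Suc (Suc k))) - ln (X (Suc k)) - ln (X k)"
      "ln (X (Suc (Suc k))) - ln (X (Suc k)) - ln (X k) \<le> ln C"
      using pos[of k] pos[of "Suc k"] C by (simp_all add: ln_mult)
    have "golden * (D (Suc k) + D k / golden)
        = golden * (ln (X (Suc (Suc k))) - ln (X (Suc k)) - ln (X k))"
    proof -
      have "golden * (D (Suc k) + D k / golden) = golden * D (Suc k) + D k"
        using g(1) by (simp add: field_simps)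
      also have "\<dots> = golden * ln (X (Suc (Suc k))) - (golden * golden) * ln (X (Suc k))
          + ln (X (Suc k)) - golden * ln (X k)"
        by (simp add: D_def algebra_simps)
      finally show ?thesis by (simp add: g(2) algebra_simps)
    qed
    then have "D (Suc k) = - (D k / golden) + (ln (X (Suc (Suc k))) - ln (X (Suc k)) - ln (X k))"
      using g(1) by simp
    moreover have "\<bar>D k / golden\<bar> \<le> K / golden"
      using Suc g(1) by (simp add: abs_divide divide_right_mono)
    ultimately show ?case using e \<open>K / golden + ln C \<le> K\<close> by linarith
  qed
  have "X (Suc k) \<le> exp K * X k powr golden" for k
  proof -
    have "ln (X (Suc k)) \<le> K + golden * ln (X k)"
      using bound[of k] unfolding D_def by linarith
    then have "exp (ln (X (Suc k))) \<le> exp (K + golden * ln (X k))" by simp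
    then show ?thesis
      using pos[of k] pos[of "Suc k"] by (simp add: exp_add powr_def)
  qed
  then show ?thesis by (intro exI[of _ "exp K"]) auto
qed

text \<open>Between two successive terms \<open>X k \<le> x < X (k + 1)\<close> the growth bound gives \<open>x \<le> c X\<^sub>k\<^sup>\<gamma>\<close>, so a
  quality \<open>1 / X k\<close> at the points of the sequence becomes a quality \<open>x\<^bsup>-1/\<gamma>\<^esup>\<close> at every scale.\<close>

lemma next_term_bound:
  fixes X :: "nat \<Rightarrow> real"
  assumes pos: "\<And>k. X k > 0" and c: "c > 0" "\<And>k. X (Suc k) \<le> c * X k powr golden"
    and "X 0 \<le> x" "\<exists>k. x < X k"
  shows "\<exists>k. X k \<le> x \<and> 1 / X k \<le> c powr (1 / golden) * x powr (- 1 / golden)"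
proof -
  define l where "l = (LEAST k. x < X k)"
  have l: "x < X l" "\<And>k. k < l \<Longrightarrow> X k \<le> x"
    unfolding l_def using assms(5) by (auto intro: LeastI_ex dest: not_less_Least)
  with assms(4) obtain k where k: "l = Suc k" by (cases l) auto
  have x: "x > 0" using pos[of 0] assms(4) by linarith
  have "x \<le> c * X k powr golden"
    using l(1) c(2)[of k] k by simp
  then have "x powr (1 / golden) \<le> (c * X k powr golden) powr (1 / golden)"
    using x golden_props(1) by (intro powr_mono2) auto
  also have "\<dots> = c powr (1 / golden) * X k"
    using c(1) pos[of k] golden_props(1) by (simp add: powr_mult powr_powr)
  finally have "1 / X k \<le> c powr (1 / golden) / x powr (1 / golden)"
    using x pos[of k] by (simp add: field_simps)
  then have "1 / X k \<le> c powr (1 / golden) * x powr (- 1 / golden)"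
    by (simp add: powr_minus divide_inverse)
  then show ?thesis using l(2)[of k] k by auto
qed

section \<open>Linear independence of consecutive points\<close>

text \<open>Cramer's rule: the determinant times each coefficient is a combination of the three values.\<close>

lemma linear_form_zero_of_det:
  fixes u v w x0 x1 x2 y0 y1 y2 z0 z1 z2 :: int
  assumes "u * x0 + v * x1 + w * x2 = 0" "u * y0 + v * y1 + w * y2 = 0" "u * z0 + v * z1 + w * z2 = 0"
    and "x0 * (y1 * z2 - y2 * z1) - x1 * (y0 * z2 - y2 * z0) + x2 * (y0 * z1 - y1 * z0) \<noteq> 0"
  shows "u = 0 \<and> v = 0 \<and> w = 0"
proof -
  define d where "d = x0 * (y1 * z2 - y2 * z1) - x1 * (y0 * z2 - y2 * z0) + x2 * (y0 * z1 - y1 * z0)"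
  have "d * u = 0" "d * v = 0" "d * w = 0"
    unfolding d_def using assms(1-3) by algebra+
  then show ?thesis using assms(4) unfolding d_def by simp
qed

text \<open>Symmetric matrices \<open>x\<close>, \<open>y\<close> and \<open>z = y N x\<close> with \<open>x\<close>, \<open>y\<close> regular and \<open>N\<close> not
  symmetric are linearly independent as points of \<open>\<int>\<^sup>3\<close>, because
  their \<open>3 \<times> 3\<close> determinant equals \<open>(N\<^sub>2\<^sub>1 - N\<^sub>1\<^sub>2) det x det y\<close>. This formula uses that \<open>z\<close> is symmetric.\<close>

lemma linear_form_zero_of_symmetric_triple:
  fixes x y N :: "int ^ 2 ^ 2" and u v w :: int
  defines "z \<equiv> y ** N ** x"
  assumes sym: "transpose x = x" "transpose y = y" "transpose z = z"
    and nz: "det x \<noteq> 0" "det y \<noteq> 0" "N $ 1 $ 2 \<noteq> N $ 2 $ 1"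
    and zero: "u * x $ 1 $ 1 + v * x $ 1 $ 2 + w * x $ 2 $ 2 = 0"
      "u * y $ 1 $ 1 + v * y $ 1 $ 2 + w * y $ 2 $ 2 = 0"
      "u * z $ 1 $ 1 + v * z $ 1 $ 2 + w * z $ 2 $ 2 = 0"
  shows "u = 0 \<and> v = 0 \<and> w = 0"
proof (rule linear_form_zero_of_det[OF zero])
  have s: "x $ 2 $ 1 = x $ 1 $ 2" "y $ 2 $ 1 = y $ 1 $ 2" "z $ 2 $ 1 = z $ 1 $ 2"
    using sym by (simp_all add: transpose_2_entries)
  have z: "z $ i $ j = (y $ i $ 1 * N $ 1 $ 1 + y $ i $ 2 * N $ 2 $ 1) * x $ 1 $ j
      + (y $ i $ 1 * N $ 1 $ 2 + y $ i $ 2 * N $ 2 $ 2) * x $ 2 $ j" for i j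
    unfolding z_def matrix_mult_2_entries ..
  \<comment> \<open>The formula is a polynomial identity only for a suitable choice between \<open>z\<^sub>1\<^sub>2\<close> and \<open>z\<^sub>2\<^sub>1\<close> at
    each place; the last summand vanishes for symmetric \<open>z\<close> and makes the identity exact.\<close>
  have "x $ 1 $ 1 * (y $ 1 $ 2 * z $ 2 $ 2 - y $ 2 $ 2 * z $ 1 $ 2)
      - x $ 1 $ 2 * (y $ 1 $ 1 * z $ 2 $ 2 - y $ 2 $ 2 * z $ 1 $ 1)
      + x $ 2 $ 2 * (y $ 1 $ 1 * z $ 1 $ 2 - y $ 1 $ 2 * z $ 1 $ 1)
    = z $ 2 $ 2 * (x $ 1 $ 1 * y $ 1 $ 2 - x $ 1 $ 2 * y $ 1 $ 1)
      + z $ 1 $ 1 * (x $ 1 $ 2 * y $ 2 $ 2 - x $ 2 $ 2 * y $ 1 $ 2)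
      + x $ 2 $ 2 * y $ 1 $ 1 * z $ 2 $ 1 - x $ 1 $ 1 * y $ 2 $ 2 * z $ 1 $ 2
      + x $ 1 $ 2 * y $ 1 $ 2 * (z $ 1 $ 2 - z $ 2 $ 1)"
    unfolding s(3) by (simp add: algebra_simps)
  also have "\<dots> = (N $ 2 $ 1 - N $ 1 $ 2) * det x * det y"
    unfolding z det_2 s(1,2) by (simp add: algebra_simps)
  finally show "x $ 1 $ 1 * (y $ 1 $ 2 * z $ 2 $ 2 - y $ 2 $ 2 * z $ 1 $ 2)
      - x $ 1 $ 2 * (y $ 1 $ 1 * z $ 2 $ 2 - y $ 2 $ 2 * z $ 1 $ 1)
      + x $ 2 $ 2 * (y $ 1 $ 1 * z $ 1 $ 2 - y $ 1 $ 2 * z $ 1 $ 1) \<noteq> 0"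
    using nz by simp
qed

section \<open>A criterion for extremality\<close>

text \<open>Multiplying by a common denominator of the coefficients clears fractions.\<close>

lemma algebraic_deg_le2_integer_relation:
  assumes "algebraic_deg_le2 \<xi>"
  shows "\<exists>u v w :: int. \<not> (u = 0 \<and> v = 0 \<and> w = 0) \<and> of_int u + of_int v * \<xi> + of_int w * \<xi>\<^sup>2 = 0"
proof -
  obtain p :: "rat poly" where p: "p \<noteq> 0" "degree p \<le> 2" "poly (map_poly of_rat p) \<xi> = 0"
    using assms unfolding algebraic_deg_le2_def by blast
  have "poly (map_poly of_rat p) \<xi> = (\<Sum>i\<le>2. coeff (map_poly of_rat p) i * \<xi> ^ i)"
    unfolding poly_altdef using p(2) degree_map_poly[of "of_rat :: rat \<Rightarrow> real" p]
    by (intro sum.mono_neutral_left) (auto intro: coeff_eq_0)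
  with p(3) have rel: "of_rat (coeff p 0) + of_rat (coeff p 1) * \<xi> + of_rat (coeff p 2) * \<xi>\<^sup>2 = 0"
    by (simp add: coeff_map_poly numeral_2_eq_2)
  have "\<exists>n d :: int. d > 0 \<and> coeff p i = of_int n / of_int d" for i
    by (metis Fract_of_int_quotient Rat_cases)
  then obtain n d :: "nat \<Rightarrow> int" where nd: "\<And>i. d i > 0" "\<And>i. coeff p i = of_int (n i) / of_int (d i)"
    by metis
  let ?u = "n 0 * d 1 * d 2" and ?v = "n 1 * d 0 * d 2" and ?w = "n 2 * d 0 * d 1"
  have d: "d i \<noteq> 0" for i using nd(1)[of i] by simp
  have "of_int ?u + of_int ?v * \<xi> + of_int ?w * \<xi>\<^sup>2 = of_int (d 0 * d 1 * d 2) *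
      (of_rat (coeff p 0) + of_rat (coeff p 1) * \<xi> + of_rat (coeff p 2) * \<xi>\<^sup>2)"
    unfolding nd(2) of_rat_divide of_rat_of_int_eq using d by (simp add: field_simps)
  then have "of_int ?u + of_int ?v * \<xi> + of_int ?w * \<xi>\<^sup>2 = 0"
    using rel by simp
  moreover have "\<not> (?u = 0 \<and> ?v = 0 \<and> ?w = 0)"
  proof
    assume "?u = 0 \<and> ?v = 0 \<and> ?w = 0"
    then have "coeff p 0 = 0" "coeff p 1 = 0" "coeff p 2 = 0"
      using d by (simp_all add: nd(2))
    then have "lead_coeff p = 0"
      using p(2) by (metis One_nat_def Suc_1 le_Suc_eq le_zero_eq)
    then show False using p(1) by simp
  qed
  ultimately show ?thesis by blast
qed

text \<open>If \<open>u + v \<xi> + w \<xi>\<^sup>2 = 0\<close>, then the integers \<open>u m\<^sub>1\<^sub>1 + v m\<^sub>1\<^sub>2 + w m\<^sub>2\<^sub>2\<close> at the points of the sequence are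
  combinations of the two approximation errors, hence tend to \<open>0\<close> and vanish from some index on.
  Three consecutive points are linearly independent, so \<open>u = v = w = 0\<close>. The argument treats
  rational and quadratic numbers alike and avoids the periodicity of their continued fractions.\<close>

lemma not_algebraic_deg_le2_criterion:
  fixes m N :: "nat \<Rightarrow> int ^ 2 ^ 2" and \<xi> :: real
  assumes sym: "\<And>k. transpose (m k) = m k"
    and det: "\<And>k. det (m k) \<noteq> 0"
    and rec: "\<And>k. m (Suc (Suc k)) = m (Suc k) ** N k ** m k"
    and asym: "\<And>k. N k $ 1 $ 2 \<noteq> N k $ 2 $ 1"
    and approx1: "(\<lambda>k. of_int (m k $ 1 $ 1) * \<xi> - of_int (m k $ 1 $ 2)) \<longlonglongrightarrow> 0"
    and approx2: "(\<lambda>k. of_int (m k $ 1 $ 1) * \<xi>\<^sup>2 - of_int (m k $ 2 $ 2)) \<longlonglongrightarrow> 0"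
  shows "\<not> algebraic_deg_le2 \<xi>"
proof
  assume "algebraic_deg_le2 \<xi>"
  then obtain u v w :: int where uvw: "\<not> (u = 0 \<and> v = 0 \<and> w = 0)"
    and rel: "of_int u + of_int v * \<xi> + of_int w * \<xi>\<^sup>2 = 0"
    using algebraic_deg_le2_integer_relation by blast
  define \<phi> where "\<phi> k = u * m k $ 1 $ 1 + v * m k $ 1 $ 2 + w * m k $ 2 $ 2" for k
  have "real_of_int (\<phi> k) = - of_int v * (of_int (m k $ 1 $ 1) * \<xi> - of_int (m k $ 1 $ 2))
      - of_int w * (of_int (m k $ 1 $ 1) * \<xi>\<^sup>2 - of_int (m k $ 2 $ 2))" for k
  proof -
    have "of_int (\<phi> k) = - of_int v * (of_int (m k $ 1 $ 1) * \<xi> - of_int (m k $ 1 $ 2))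
      - of_int w * (of_int (m k $ 1 $ 1) * \<xi>\<^sup>2 - of_int (m k $ 2 $ 2))
      + of_int (m k $ 1 $ 1) * (of_int u + of_int v * \<xi> + of_int w * \<xi>\<^sup>2)"
      unfolding \<phi>_def by (simp add: algebra_simps)
    then show ?thesis using rel by simp
  qed
  moreover have "(\<lambda>k. - of_int v * (of_int (m k $ 1 $ 1) * \<xi> - of_int (m k $ 1 $ 2))
      - of_int w * (of_int (m k $ 1 $ 1) * \<xi>\<^sup>2 - of_int (m k $ 2 $ 2)))
      \<longlonglongrightarrow> - of_int v * 0 - of_int w * 0"
    by (intro tendsto_intros approx1 approx2)
  ultimately have "(\<lambda>k. real_of_int (\<phi> k)) \<longlonglongrightarrow> 0" by simp
  then have "eventually (\<lambda>k. \<bar>real_of_int (\<phi> k)\<bar> < 1) sequentially"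
    by (auto dest: tendstoD[where e = 1])
  then obtain K where "\<And>k. k \<ge> K \<Longrightarrow> \<phi> k = 0"
    unfolding eventually_sequentially by fastforce
  then have "\<phi> K = 0" "\<phi> (Suc K) = 0" "\<phi> (Suc (Suc K)) = 0" by auto
  then have "u = 0 \<and> v = 0 \<and> w = 0"
    using linear_form_zero_of_symmetric_triple[of "m K" "m (Suc K)" "N K" u v w] sym det asym
    unfolding \<phi>_def rec[symmetric] by blast
  with uvw show False ..
qed

text \<open>The growth of the first coordinates turns errors \<open>C' / X k\<close> at the points of the sequence into
  solutions at all scales, and the recursion excludes algebraic numbers of degree at most two.\<close>

lemma extremal_criterion:
  fixes m N :: "nat \<Rightarrow> int ^ 2 ^ 2" and \<xi> C C' :: real
  assumes sym: "\<And>k. transpose (m k) = m k"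
    and det: "\<And>k. det (m k) \<noteq> 0"
    and rec: "\<And>k. m (Suc (Suc k)) = m (Suc k) ** N k ** m k"
    and asym: "\<And>k. N k $ 1 $ 2 \<noteq> N k $ 2 $ 1"
    and X: "\<And>k. X k = real_of_int (m k $ 1 $ 1)"
    and X0: "X 0 = 1" and Xpos: "\<And>k. X k > 0" and Xlarge: "filterlim X at_top sequentially"
    and lower: "\<And>k. X (Suc k) * X k \<le> X (Suc (Suc k))"
    and upper: "\<And>k. X (Suc (Suc k)) \<le> C * (X (Suc k) * X k)"
    and approx1: "\<And>k. \<bar>X k * \<xi> - of_int (m k $ 1 $ 2)\<bar> \<le> C' / X k"
    and approx2: "\<And>k. \<bar>X k * \<xi>\<^sup>2 - of_int (m k $ 2 $ 2)\<bar> \<le> C' / X k"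
  shows "extremal \<xi>"
  unfolding extremal_def
proof (intro conjI)
  have lim: "(\<lambda>k. C' / X k) \<longlonglongrightarrow> 0"
    using Xlarge by (intro real_tendsto_divide_at_top[OF tendsto_const])
  have "(\<lambda>k. X k * \<xi> - of_int (m k $ 1 $ 2)) \<longlonglongrightarrow> 0"
    "(\<lambda>k. X k * \<xi>\<^sup>2 - of_int (m k $ 2 $ 2)) \<longlonglongrightarrow> 0"
    using approx1 approx2 by (auto intro!: Lim_null_comparison[OF _ lim])
  then show "\<not> algebraic_deg_le2 \<xi>"
    unfolding X by (intro not_algebraic_deg_le2_criterion[where m = m and N = N] sym det rec asym)
  obtain c where c: "c > 0" "\<And>k. X (Suc k) \<le> c * X k powr golden"
    using fibonacci_growth[where X = X and C = C] Xpos lower upper by blast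
  have "C' \<ge> 0"
    using approx1[of 0] X0 by simp
  \<comment> \<open>The summand \<open>1\<close> makes the constant positive also for \<open>C' = 0\<close>.\<close>
  define c' where "c' = C' * c powr (1 / golden) + 1"
  show "\<exists>c'>0. \<forall>X::real. X \<ge> 1 \<longrightarrow>
        (\<exists>x0 x1 x2 :: int. (x0, x1, x2) \<noteq> (0, 0, 0) \<and>
           \<bar>of_int x0\<bar> \<le> X \<and>
           \<bar>of_int x0 * \<xi> - of_int x1\<bar> \<le> c' * X powr (- 1 / golden) \<and>
           \<bar>of_int x0 * \<xi>\<^sup>2 - of_int x2\<bar> \<le> c' * X powr (- 1 / golden))"
  proof (intro exI[of _ c'] conjI allI impI)
    show "c' > 0"
      using \<open>C' \<ge> 0\<close> by (simp add: c'_def add_nonneg_pos)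
    fix x :: real assume "x \<ge> 1"
    have "\<exists>k. x < X k"
      using Xlarge by (metis eventually_sequentially filterlim_at_top_dense order_refl)
    then obtain k where k: "X k \<le> x" "1 / X k \<le> c powr (1 / golden) * x powr (- 1 / golden)"
      using next_term_bound[where X = X and c = c and x = x] Xpos c X0 \<open>x \<ge> 1\<close> by auto
    have "C' / X k \<le> C' * (c powr (1 / golden) * x powr (- 1 / golden))"
      using mult_left_mono[OF k(2) \<open>C' \<ge> 0\<close>] by simp
    also have "\<dots> \<le> c' * x powr (- 1 / golden)"
      by (simp add: c'_def algebra_simps)
    finally have "C' / X k \<le> c' * x powr (- 1 / golden)" .
    then show "\<exists>x0 x1 x2 :: int. (x0, x1, x2) \<noteq> (0, 0, 0) \<and>
           \<bar>of_int x0\<bar> \<le> x \<and>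
           \<bar>of_int x0 * \<xi> - of_int x1\<bar> \<le> c' * x powr (- 1 / golden) \<and>
           \<bar>of_int x0 * \<xi>\<^sup>2 - of_int x2\<bar> \<le> c' * x powr (- 1 / golden)"
      using k(1) approx1[of k] approx2[of k] Xpos[of k] unfolding X
      by (intro exI[of _ "m k $ 1 $ 1"] exI[of _ "m k $ 1 $ 2"] exI[of _ "m k $ 2 $ 2"]) auto
  qed
qed

section \<open>The bracket sequence\<close>

lemma matrix_mult_uminus:
  fixes M N :: "int ^ 2 ^ 2"
  shows "(- M) ** N = - (M ** N)" "M ** (- N) = - (M ** N)"
  by (simp_all add: vec_eq_iff matrix_mult_2_entries)

text \<open>For symmetric \<open>Z\<close> of determinant \<open>\<plusminus> 1\<close> one has \<open>J Z J = \<mp> Z\<^sup>-\<^sup>1\<close>. The bracket is thus \<open>\<plusminus> X Z\<^sup>-\<^sup>1 X\<close>,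
  which is \<open>\<plusminus> X R\<close> for \<open>X = Z R\<close>: bracketing extends a product without any inverse remaining. The
  signs are not tracked since only ratios of coordinates matter.\<close>

lemma bracket_sign_invariant:
  assumes "point_matrix x = X \<or> point_matrix x = - X" "point_matrix z = Z \<or> point_matrix z = - Z"
    and Z: "transpose Z = Z" "\<bar>det Z\<bar> = 1" and X: "X = Z ** R"
  shows "point_matrix (bracket x z) = X ** R \<or> point_matrix (bracket x z) = - (X ** R)"
proof -
  have "Z $ 2 $ 1 = Z $ 1 $ 2"
    using Z(1) by (rule transpose_2_entries)
  then have "J ** Z ** J ** Z = mat (- det Z)"
    by (simp add: vec_eq_iff forall_2 matrix_mult_2_entries J_def det_2 mat_def)
  then have JZ: "J ** Z ** J ** Z = mat 1 \<or> J ** Z ** J ** Z = - mat 1"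
    using Z(2) by (auto simp: abs_if mat_def vec_eq_iff split: if_splits)
  have "X ** J ** Z ** J ** X = X ** (J ** Z ** J ** Z) ** R"
    unfolding X by (simp add: matrix_mul_assoc)
  then have "X ** J ** Z ** J ** X = X ** R \<or> X ** J ** Z ** J ** X = - (X ** R)"
    using JZ by (auto simp: matrix_mult_uminus)
  then show ?thesis
    using assms(1,2) unfolding point_matrix_bracket by (auto simp: matrix_mult_uminus)
qed

lemma point_matrix_matrix_point:
  assumes "transpose M = M"
  shows "point_matrix (matrix_point M) = M"
proof -
  have "M $ 2 $ 1 = M $ 1 $ 2"
    using assms by (rule transpose_2_entries)
  then show ?thesis
    by (simp add: point_matrix_def matrix_point_def vec_eq_iff forall_2)
qed

lemma transpose_cf_matrix_central_word:
  "transpose (cf_matrix (central_word a b k)) = cf_matrix (central_word a b k)"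
  by (metis cf_matrix_rev rev_central_word)

lemma abs_det_cf_matrix: "\<bar>det (cf_matrix ws)\<bar> = 1"
  by (simp add: det_cf_matrix power_abs)

text \<open>The bracket recursion takes \<open>X = m\<^bsub>k+2\<^esub>\<close> and \<open>Z = m\<^sub>k\<close>. By the second factorization of central words
  \<open>X = Z R\<close>, where \<open>R\<close> belongs to the two extra letters followed by the word of index \<open>k + 1\<close>; and
  \<open>X R = m\<^bsub>k+3\<^esub>\<close> by their recursion, as the extra letters have period two in \<open>k\<close>. The step to index
  \<open>2\<close> is the same with \<open>Z = B\<^sup>-\<^sup>1\<close> and \<open>R = B A\<close>.\<close>

lemma y_seq_central_word:
  fixes a b :: int
  defines "A \<equiv> vector [vector [a, 1], vector [1, 0]]" and "B \<equiv> vector [vector [b, 1], vector [1, 0]]"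
  shows "point_matrix (y_seq A B (int k)) = cf_matrix (central_word a b k) \<or>
    point_matrix (y_seq A B (int k)) = - cf_matrix (central_word a b k)"
proof (induction k rule: less_induct)
  case (less k)
  let ?m = "\<lambda>k. cf_matrix (central_word a b k)"
  consider "k = 0" | "k = 1" | "k = 2" | j where "k = Suc (Suc (Suc j))"
    by (metis One_nat_def Suc_1 not0_implies_Suc)
  then show ?case
  proof cases
    case 1
    then show ?thesis
      by (simp add: y_seq.simps point_matrix_matrix_point transpose_mat)
  next
    case 2
    have "transpose A = A"
      by (simp add: A_def transpose_def vec_eq_iff forall_2)
    with 2 show ?thesis
      by (simp add: y_seq.simps point_matrix_matrix_point A_def)
  next
    case 3
    define D :: "int ^ 2 ^ 2" where "D = vector [vector [0, 1], vector [1, - b]]"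
    have BD: "B ** D = mat 1" "D ** B = mat 1"
      by (simp_all add: B_def D_def vec_eq_iff forall_2 matrix_mult_2_entries mat_def)
    have "matrix_inv B ** B = mat 1"
      unfolding matrix_inv_def by (rule someI2[of _ D]) (use BD in auto)
    then have inv: "matrix_inv B = D"
      by (metis BD(1) matrix_mul_assoc matrix_mul_lid matrix_mul_rid)
    have D: "transpose D = D" "\<bar>det D\<bar> = 1"
      by (simp_all add: D_def transpose_def vec_eq_iff forall_2 det_2)
    have y: "y_seq A B (int k) = bracket (y_seq A B (int 1)) (y_seq A B (- 1))"
      using 3 by (subst y_seq.simps) simp
    have m: "?m k = ?m 1 ** (B ** A)" and m1: "?m 1 = A"
      using 3 by (simp_all add: numeral_2_eq_2 pair_word_def A_def B_def matrix_mul_assoc)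
    have "point_matrix (y_seq A B (- 1)) = D"
      by (simp add: y_seq.simps inv point_matrix_matrix_point D)
    moreover have "?m 1 = D ** (B ** A)"
      unfolding m1 by (simp add: matrix_mul_assoc BD)
    ultimately show ?thesis
      using bracket_sign_invariant[of _ "?m 1" _ D "B ** A"] less.IH[of 1] 3 D
      unfolding y m by simp
  next
    case 4
    let ?R = "cf_matrix (pair_word a b j) ** ?m (Suc j)"
    have y: "y_seq A B (int k) = bracket (y_seq A B (int (Suc (Suc j)))) (y_seq A B (int j))"
      using 4 by (subst y_seq.simps) (simp add: algebra_simps)
    have m2: "?m (Suc (Suc j)) = ?m j ** ?R"
      by (simp only: central_word_swap cf_matrix_append)
    have m: "?m k = ?m (Suc (Suc j)) ** ?R"
      unfolding 4 by (simp only: central_word.simps(3)[of a b "Suc j"] cf_matrix_append pair_word_Suc_Suc)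
    show ?thesis
      unfolding y m
      by (rule bracket_sign_invariant[OF less.IH less.IH transpose_cf_matrix_central_word abs_det_cf_matrix m2])
        (simp_all add: 4)
  qed
qed

section \<open>Fibonacci continued fractions\<close>

text \<open>The upper left entry, the continuant of the word, is multiplicative up to a factor two because
  it dominates the other entries.\<close>

lemma cf_matrix_append_11:
  assumes "\<forall>c\<in>set us. c > 0" "\<forall>c\<in>set vs. c > 0"
  shows "cf_matrix us $ 1 $ 1 * cf_matrix vs $ 1 $ 1 \<le> cf_matrix (us @ vs) $ 1 $ 1"
    and "cf_matrix (us @ vs) $ 1 $ 1 \<le> 2 * (cf_matrix us $ 1 $ 1 * cf_matrix vs $ 1 $ 1)"
proof -
  note us = cf_matrix_entries[OF assms(1)] and vs = cf_matrix_entries[OF assms(2)]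
  have "0 \<le> cf_matrix us $ 1 $ 2 * cf_matrix vs $ 2 $ 1"
    using us vs by simp
  moreover have "cf_matrix us $ 1 $ 2 * cf_matrix vs $ 2 $ 1 \<le> cf_matrix us $ 1 $ 1 * cf_matrix vs $ 1 $ 1"
    using us vs by (intro mult_mono) auto
  ultimately show "cf_matrix us $ 1 $ 1 * cf_matrix vs $ 1 $ 1 \<le> cf_matrix (us @ vs) $ 1 $ 1"
    "cf_matrix (us @ vs) $ 1 $ 1 \<le> 2 * (cf_matrix us $ 1 $ 1 * cf_matrix vs $ 1 $ 1)"
    unfolding cf_matrix_append matrix_mult_2_entries by linarith+
qed

lemma central_word_denominator_bounds:
  fixes a b :: int
  assumes "a > 0" "b > 0"
  defines "q \<equiv> \<lambda>k. cf_matrix (central_word a b k) $ 1 $ 1"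
  shows "q (Suc k) * q k \<le> q (Suc (Suc k))"
    and "q (Suc (Suc k)) \<le> 4 * (a * b + 1) * (q (Suc k) * q k)"
proof -
  let ?p = "pair_word a b (Suc k)"
  have pos: "\<forall>c\<in>set (central_word a b i). c > 0" "\<forall>c\<in>set (pair_word a b i). c > 0" for i
    using set_central_word[of a b i] assms by (auto simp: pair_word_def)
  have p: "cf_matrix ?p $ 1 $ 1 = a * b + 1"
    by (simp add: pair_word_def cf_matrix_Cons_entries mat_def del: cf_matrix.simps(2))
  have q: "q i = cf_matrix (central_word a b i) $ 1 $ 1" for i
    by (simp add: q_def)
  have q1: "q i \<ge> 1" for i
    unfolding q_def using cf_matrix_entries(1)[OF pos(1)] .
  note inner = cf_matrix_append_11[OF pos(2) pos(1), of "Suc k" k, unfolded p, folded q]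
  have "\<forall>c\<in>set (?p @ central_word a b k). c > 0"
    using pos by auto
  note outer = cf_matrix_append_11[OF pos(1)[of "Suc k"] this, folded central_word.simps(3), folded q]
  have "q k \<le> (a * b + 1) * q k"
    using assms q1[of k] by (simp add: algebra_simps)
  then have "q (Suc k) * q k \<le> q (Suc k) * cf_matrix (?p @ central_word a b k) $ 1 $ 1"
    using inner(1) q1[of "Suc k"] by (intro mult_left_mono) auto
  with outer(1) show "q (Suc k) * q k \<le> q (Suc (Suc k))"
    by (simp add: q_def)
  have "q (Suc k) * cf_matrix (?p @ central_word a b k) $ 1 $ 1 \<le> q (Suc k) * (2 * ((a * b + 1) * q k))"
    using inner(2) q1[of "Suc k"] by (intro mult_left_mono) auto
  with outer(2) show "q (Suc (Suc k)) \<le> 4 * (a * b + 1) * (q (Suc k) * q k)"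
    by (simp add: q_def algebra_simps)
qed

text \<open>For a symmetric matrix \<open>m\<close> the second estimate follows from
  \<open>m\<^sub>1\<^sub>1 \<xi>\<^sup>2 - m\<^sub>2\<^sub>2 = \<xi> (m\<^sub>1\<^sub>1 \<xi> - m\<^sub>1\<^sub>2) + (m\<^sub>1\<^sub>2 \<xi> - m\<^sub>2\<^sub>2)\<close> and \<open>\<bar>\<xi>\<bar> \<le> 1\<close>; this is where palindromes give simultaneous
  approximations to \<open>\<xi>\<close> and \<open>\<xi>\<^sup>2\<close>.\<close>

lemma
  fixes a b :: int
  assumes "a > 0" "b > 0"
  defines "m \<equiv> \<lambda>k. cf_matrix (central_word a b k)"
  shows fib_cf_approx1: "\<bar>of_int (m k $ 1 $ 1) * fib_cf a b - of_int (m k $ 1 $ 2)\<bar> \<le> 1 / of_int (m k $ 1 $ 1)"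
    and fib_cf_approx2: "\<bar>of_int (m k $ 1 $ 1) * (fib_cf a b)\<^sup>2 - of_int (m k $ 2 $ 2)\<bar> \<le> 2 / of_int (m k $ 1 $ 1)"
proof -
  let ?\<xi> = "fib_cf a b"
  have pos: "fib_word a b n > 0" for n
    using fib_word_in[of a b n] assms by auto
  have m21: "m k $ 2 $ 1 = m k $ 1 $ 2"
    unfolding m_def by (rule transpose_2_entries[OF transpose_cf_matrix_central_word])
  have appr: "\<bar>of_int (m k $ 1 $ j) * ?\<xi> - of_int (m k $ 2 $ j)\<bar> \<le> 1 / of_int (m k $ 1 $ 1)" for j
    using cf_value_approx[where f = "fib_word a b" and n = "length (central_word a b k)" and j = j] pos
    unfolding central_word_prefix m_def fib_cf_def by blast
  show *: "\<bar>of_int (m k $ 1 $ 1) * ?\<xi> - of_int (m k $ 1 $ 2)\<bar> \<le> 1 / of_int (m k $ 1 $ 1)"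
    using appr[of 1] by (simp add: m21)
  \<comment> \<open>The empty prefix has the identity matrix and gives the bound for \<open>\<bar>\<xi>\<bar>\<close>.\<close>
  have "\<bar>?\<xi>\<bar> \<le> 1"
    using cf_value_approx[where f = "fib_word a b" and n = 0 and j = 1] pos by (simp add: fib_cf_def mat_def)
  then have "\<bar>?\<xi>\<bar> * \<bar>of_int (m k $ 1 $ 1) * ?\<xi> - of_int (m k $ 1 $ 2)\<bar> \<le> 1 / of_int (m k $ 1 $ 1)"
    using * mult_right_mono[of "\<bar>?\<xi>\<bar>" 1 "\<bar>of_int (m k $ 1 $ 1) * ?\<xi> - of_int (m k $ 1 $ 2)\<bar>"] by simp
  moreover have "of_int (m k $ 1 $ 1) * ?\<xi>\<^sup>2 - of_int (m k $ 2 $ 2)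
      = ?\<xi> * (of_int (m k $ 1 $ 1) * ?\<xi> - of_int (m k $ 1 $ 2)) + (of_int (m k $ 1 $ 2) * ?\<xi> - of_int (m k $ 2 $ 2))"
    by (simp add: algebra_simps power2_eq_square)
  ultimately show "\<bar>of_int (m k $ 1 $ 1) * ?\<xi>\<^sup>2 - of_int (m k $ 2 $ 2)\<bar> \<le> 2 / of_int (m k $ 1 $ 1)"
    using appr[of 2] abs_mult[of ?\<xi> "of_int (m k $ 1 $ 1) * ?\<xi> - of_int (m k $ 1 $ 2)"]
    by linarith
qed

lemma extremal_fib_cf:
  fixes a b :: int
  assumes "a > 0" "b > 0" "a \<noteq> b"
  shows "extremal (fib_cf a b)"
proof (rule extremal_criterion)
  let ?m = "\<lambda>k. cf_matrix (central_word a b k)"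
  let ?X = "\<lambda>k. real_of_int (?m k $ 1 $ 1)"
  have pos: "\<forall>c\<in>set (central_word a b k). c > 0" for k
    using set_central_word[of a b k] assms by auto
  note entries = cf_matrix_entries[OF pos]
  show "transpose (?m k) = ?m k" for k
    by (rule transpose_cf_matrix_central_word)
  show "det (?m k) \<noteq> 0" for k
    using abs_det_cf_matrix[of "central_word a b k"] by auto
  show "?m (Suc (Suc k)) = ?m (Suc k) ** cf_matrix (pair_word a b (Suc k)) ** ?m k" for k
    by (simp add: cf_matrix_append matrix_mul_assoc)
  show "cf_matrix (pair_word a b (Suc k)) $ 1 $ 2 \<noteq> cf_matrix (pair_word a b (Suc k)) $ 2 $ 1" for k
    using assms(3) by (simp add: pair_word_def cf_matrix_Cons_entries mat_def del: cf_matrix.simps(2))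
  show "?X k = ?X k" for k ..
  show "?X 0 = 1" by (simp add: mat_def)
  show "?X k > 0" for k using entries(1)[of k] by linarith
  show "filterlim ?X at_top sequentially"
  proof (rule filterlim_at_top_mono[OF filterlim_real_sequentially])
    have "real k \<le> ?X k" for k
      using entries(4)[of k] length_central_word[of k a b] by linarith
    then show "eventually (\<lambda>k. real k \<le> ?X k) sequentially" by simp
  qed
  show "?X (Suc k) * ?X k \<le> ?X (Suc (Suc k))" for k
    using central_word_denominator_bounds(1)[OF assms(1,2), of k] by (simp only: of_int_le_iff flip: of_int_mult)
  show "?X (Suc (Suc k)) \<le> of_int (4 * (a * b + 1)) * (?X (Suc k) * ?X k)" for k
    using central_word_denominator_bounds(2)[OF assms(1,2), of k] by (simp only: of_int_le_iff flip: of_int_mult)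
  show "\<bar>?X k * fib_cf a b - of_int (?m k $ 1 $ 2)\<bar> \<le> 2 / ?X k" for k
    using fib_cf_approx1[OF assms(1,2), of k] entries(1)[of k]
      divide_right_mono[of 1 2 "?X k"] by simp
  show "\<bar>?X k * (fib_cf a b)\<^sup>2 - of_int (?m k $ 2 $ 2)\<bar> \<le> 2 / ?X k" for k
    using fib_cf_approx2[OF assms(1,2), of k] .
qed

text \<open>Up to a common sign the coordinates of \<open>y k\<close> are the denominator and the numerator of the
  convergent that belongs to a palindromic prefix, and these form a subsequence of the convergents.\<close>

lemma y_seq_ratio_tendsto:
  fixes a b :: int
  assumes "a > 0" "b > 0"
  defines "y \<equiv> y_seq (vector [vector [a, 1], vector [1, 0]]) (vector [vector [b, 1], vector [1, 0]])"
  shows "(\<lambda>k. real_of_int (y (int k) $ 2) / real_of_int (y (int k) $ 1)) \<longlonglongrightarrow> fib_cf a b"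
proof -
  let ?m = "\<lambda>k. cf_matrix (central_word a b k)" and ?n = "\<lambda>k. length (central_word a b k)"
  have pos: "fib_word a b n > 0" for n
    using fib_word_in[of a b n] assms by auto
  have "filterlim ?n at_top sequentially"
    by (rule filterlim_at_top_mono[OF filterlim_ident]) (simp add: length_central_word)
  then have "(\<lambda>k. cf_convergent (case_nat 0 (fib_word a b)) (?n k)) \<longlonglongrightarrow> fib_cf a b"
    unfolding fib_cf_def by (intro filterlim_compose[OF cf_convergent_tendsto[where f = "fib_word a b"]] pos)
  moreover have "cf_convergent (case_nat 0 (fib_word a b)) (?n k) = of_int (y (int k) $ 2) / of_int (y (int k) $ 1)" for k
  proof -
    have "of_int (y (int k) $ 2) / of_int (y (int k) $ 1)
        = real_of_int (point_matrix (y (int k)) $ 2 $ 1) / of_int (point_matrix (y (int k)) $ 1 $ 1)"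
      by (simp add: point_matrix_def)
    also have "\<dots> = of_int (?m k $ 2 $ 1) / of_int (?m k $ 1 $ 1)"
      using y_seq_central_word[of a b k] unfolding y_def by auto
    also have "\<dots> = cf_convergent (case_nat 0 (fib_word a b)) (?n k)"
      using cf_convergent_matrix[where f = "fib_word a b" and c = 0 and n = "?n k"] pos
      unfolding central_word_prefix by simp
    finally show ?thesis ..
  qed
  ultimately show ?thesis by simp
qed

theorem corollary6p3:
  fixes a b :: int and \<xi> :: real and A B :: "int ^ 2 ^ 2"
  assumes "a > 0" and "b > 0" and "a \<noteq> b"
    and "\<xi> = fib_cf a b"
    and "A = vector [vector [a, 1], vector [1, 0]]"
    and "B = vector [vector [b, 1], vector [1, 0]]"
  shows "extremal \<xi> \<and>
         invertible A \<and> invertible B \<and>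
         transpose A = A \<and> transpose B = B \<and>
         A ** B \<noteq> B ** A \<and>
         (\<forall>i j. A $ i $ j \<ge> 0) \<and>
         (\<forall>i j. (A ** B) $ i $ j > 0) \<and>
         (\<lambda>k::nat. real_of_int (y_seq A B (int k) $ 2) / real_of_int (y_seq A B (int k) $ 1))
           \<longlonglongrightarrow> \<xi>"
proof (intro conjI)
  show "extremal \<xi>"
    using extremal_fib_cf assms by simp
  show "(\<lambda>k::nat. real_of_int (y_seq A B (int k) $ 2) / real_of_int (y_seq A B (int k) $ 1)) \<longlonglongrightarrow> \<xi>"
    using y_seq_ratio_tendsto[of a b] assms by simp
  have inv: "invertible (vector [vector [c, 1], vector [1, 0]] :: int ^ 2 ^ 2)" for c
    unfolding invertible_def
    by (rule exI[of _ "vector [vector [0, 1], vector [1, - c]]"])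
      (simp add: vec_eq_iff forall_2 matrix_mult_2_entries mat_def)
  show "invertible A" "invertible B"
    using inv assms by simp_all
  show "transpose A = A" "transpose B = B"
    using assms(5,6) by (simp_all add: transpose_def vec_eq_iff forall_2)
  show "A ** B \<noteq> B ** A"
  proof
    assume "A ** B = B ** A"
    then have "(A ** B) $ 1 $ 2 = (B ** A) $ 1 $ 2" by simp
    then show False using assms(3,5,6) by (simp add: matrix_mult_2_entries)
  qed
  show "\<forall>i j. A $ i $ j \<ge> 0"
    using assms by (simp add: forall_2)
  have "a * b > 0" using assms by simp
  then show "\<forall>i j. (A ** B) $ i $ j > 0"
    using assms by (simp add: forall_2 matrix_mult_2_entries)
qed

end
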